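(* Let $G$ and $H$ be graphs with disjoint vertex sets and with $n_G \geq 1$ and $n_H \geq 1$ vertices, respectively. Let $w_G \colon E(G) \to \mathbb{R}_{++}$ and $w_H \colon E(H) \to \mathbb{R}_{++}$ be weight functions, and denote the respective weighted Laplacians by $L_G := \mathcal{L}_G(w_G)$ and $L_H := \mathcal{L}_H(w_H)$. Set $\mu_G := \lambda_{\max}(L_G)$ and $\mu_H := \lambda_{\max}(L_H)$. Suppose that $n_G \mu_G > n_H \mu_H$ and that $H$ is connected. Let $F$ be the cosum of $G$ and $H$, and define $\bar{w} \colon E(F) \to \mathbb{R}_{++}$ by $\bar w := w_G \oplus w_H \oplus \alpha \mathbf{1}$ where $\alpha := \mu_G/n_H$; that is, $\bar w$ agrees with $w_G$ on $E(G)$, agrees with $w_H$ on $E(H)$, and equals $\alpha$ on every edge joining $V(G)$ and $V(H)$. Denote the all-ones vectors in $\mathbb{R}^{V(G)}$ and $\mathbb{R}^{V(H)}$ by $\mathbf{1}_G$ and $\mathbf{1}_H$, respectively. Then the unique pair of primal-dual optimal solutions for the MaxCut SDP and its dual with objective matrix $C := \mathcal{L}_{F}(\bar w)$ is $(X^*, (y^*, S^* ))$, where $$X^* := \begin{bmatrix} -\mathbf{1}_G \\ \mathbf{1}_H \end{bmatrix}\begin{bmatrix} -\mathbf{1}_G \\ \mathbf{1}_H \end{bmatrix}^{\top}, \quad y^* := 2\alpha \begin{bmatrix} n_H \mathbf{1}_G \\ n_G \mathbf{1}_H \end{bmatrix}, \quad S^* := \begin{bmatrix} \mu_G I - L_G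 & \alpha \mathbf{1}_G \mathbf{1}_H^{\top} \\ \alpha \mathbf{1}_H \mathbf{1}_G^{\top} & \alpha n_G I - L_H \end{bmatrix}.$$ In particular, since $(X^*+S^* )(h \oplus 0) = 0$ for any eigenvector $h$ of $L_G$ with eigenvalue $\mu_G$, there is no strictly complementary pair of primal-dual optimal solutions for this MaxCut SDP and its dual.
   Context: $\mathbb{R}_{++}$ is the set of positive reals. $\lambda_{\max}(A)$ is the largest eigenvalue of a symmetric matrix $A$. For a graph $G=(V,E)$ and $w \colon E \to \mathbb{R}$, the weighted Laplacian is $\mathcal{L}_G(w) := \sum_{\{i,j\} \in E} w_{\{i,j\}} (e_i-e_j)(e_i-e_j)^{\top}$, where the $e_i$ are the standard basis vectors of $\mathbb{R}^V$. If $G=(V,E)$ and $H=(U,F')$ are graphs with $V \cap U = \emptyset$, their cosum is the graph with vertex set $V \cup U$ and edge set $E \cup F' \cup \{\{v,u\} : (v,u) \in V \times U\}$. The symbol $\oplus$ denotes the direct sum (concatenation) of vectors. For a symmetric real $n \times n$ matrix $C$, the MaxCut SDP is $\max\{\mathrm{Tr}(CX) : \mathrm{diag}(X) = \mathbf{1},\ X \succeq 0\}$ over symmetric $n\times n$ matrices $X$, and its dual is $\min\{\mathbf{1}^{\top} y : S = \mathrm{Diag}(y) - C,\ S \succeq 0\}$ over $y \in \mathbb{R}^n$ and symmetric $S$. Here $\mathrm{diag}$ extracts the diagonal, $\mathrm{Diag}(y)$ is the diagonal matrix with diagonal $y$, $\mathbf{1}$ is the all-ones vector, and $\succeq 0$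 (resp. $\succ 0$) means positive semidefinite (resp. positive definite). A pair $(X,(y,S))$ of primal-dual feasible solutions is strictly complementary if $XS = 0$ and $X + S \succ 0$. *)

theory Defs
  imports "HOL-Analysis.Analysis"
begin

section \<open>Graphs\<close>

text \<open>
  A finite simple graph is given by its edge set \<open>E :: 'v set set\<close>; its vertex set is the whole
  finite type \<open>'v\<close>, so that vectors in \<open>\<real>\<^sup>V\<close> are elements of \<^typ>\<open>real^'v\<close>. In particular
  the number of vertices is \<open>CARD('v) \<ge> 1\<close>. Edges need not exist.
\<close>

definition simple_graph :: "'v::finite set set \<Rightarrow> bool" where
  "simple_graph E \<longleftrightarrow> (\<forall>e\<in>E. card e = 2)"

definition connected_graph :: "'v::finite set set \<Rightarrow> bool" where
  "connected_graph E \<longleftrightarrow> (\<forall>u v. (u, v) \<in> {(a, b). {a, b} \<in> E}\<^sup>*)"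

text \<open>
  The disjoint vertex sets of the two graphs are the two summands of a sum type.
\<close>

definition cosum :: "'g::finite set set \<Rightarrow> 'h::finite set set \<Rightarrow> ('g + 'h) set set" where
  "cosum EG EH =
     (\<lambda>e. Inl ` e) ` EG \<union> (\<lambda>e. Inr ` e) ` EH \<union> {{Inl v, Inr u} | v u. True}"

text \<open>The weights \<open>w\<^sub>G \<oplus> w\<^sub>H \<oplus> \<alpha> \<one>\<close>; only the values on edges of the cosum matter.\<close>

definition cosum_weight ::
  "('g set \<Rightarrow> real) \<Rightarrow> ('h set \<Rightarrow> real) \<Rightarrow> real \<Rightarrow> ('g + 'h) set \<Rightarrow> real" where
  "cosum_weight wG wH \<alpha> e =
     (if e \<subseteq> range Inl then wG (Inl -` e)
      else if e \<subseteq> range Inr then wH (Inr -` e)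
      else \<alpha>)"

lemma cosum_weight_simps:
  "e \<noteq> {} \<Longrightarrow> cosum_weight wG wH \<alpha> (Inl ` e) = wG e"
  "e \<noteq> {} \<Longrightarrow> cosum_weight wG wH \<alpha> (Inr ` e) = wH e"
  "cosum_weight wG wH \<alpha> {Inl v, Inr u} = \<alpha>"
  by (auto simp: cosum_weight_def inj_vimage_image_eq)

section \<open>Matrices\<close>

definition outer :: "real^'m \<Rightarrow> real^'n \<Rightarrow> real^'n^'m" where
  "outer u v = (\<chi> i j. u $ i * v $ j)"

definition Diag :: "real^'n \<Rightarrow> real^'n^'n" where
  "Diag y = (\<chi> i j. if i = j then y $ i else 0)"

definition diag :: "real^'n^'n \<Rightarrow> real^'n" where
  "diag X = (\<chi> i. X $ i $ i)"

definition dsum :: "real^'m \<Rightarrow> real^'n \<Rightarrow> real^('m + 'n)" (infixr "\<oplus>\<^sub>v" 65) where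
  "u \<oplus>\<^sub>v v = (\<chi> k. case k of Inl i \<Rightarrow> u $ i | Inr j \<Rightarrow> v $ j)"

definition block_matrix ::
  "real^'m^'m \<Rightarrow> real^'n^'m \<Rightarrow> real^'m^'n \<Rightarrow> real^'n^'n \<Rightarrow> real^('m + 'n)^('m + 'n)" where
  "block_matrix A B C D =
     (\<chi> k. case k of Inl i \<Rightarrow> A $ i \<oplus>\<^sub>v B $ i | Inr j \<Rightarrow> C $ j \<oplus>\<^sub>v D $ j)"

definition eigenvector :: "real^'n^'n \<Rightarrow> real^'n \<Rightarrow> real \<Rightarrow> bool" where
  "eigenvector A v l \<longleftrightarrow> v \<noteq> 0 \<and> A *v v = l *\<^sub>R v"

text \<open>
  For symmetric \<open>A\<close> the set of real eigenvalues is finite and nonempty, so that \<^const>\<open>Max\<close> is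
  meaningful; the definition is not intended for other matrices.
\<close>

definition lambda_max :: "real^'n^'n \<Rightarrow> real" where
  "lambda_max A = Max {l. \<exists>v. eigenvector A v l}"

definition psd :: "real^'n^'n \<Rightarrow> bool" where
  "psd A \<longleftrightarrow> transpose A = A \<and> (\<forall>x. 0 \<le> x \<bullet> (A *v x))"

definition pos_def :: "real^'n^'n \<Rightarrow> bool" where
  "pos_def A \<longleftrightarrow> transpose A = A \<and> (\<forall>x. x \<noteq> 0 \<longrightarrow> 0 < x \<bullet> (A *v x))"

section \<open>Weighted Laplacian\<close>

text \<open>
  The matrix \<open>(e\<^sub>i - e\<^sub>j) (e\<^sub>i - e\<^sub>j)\<^sup>T\<close> depends only on the unordered pair \<open>{i, j}\<close>; see
  \<open>edge_matrix_insert\<close> below.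
\<close>

definition edge_matrix :: "'v::finite set \<Rightarrow> real^'v^'v" where
  "edge_matrix e =
     (THE M. \<exists>i j. e = {i, j} \<and> M = outer (axis i 1 - axis j 1) (axis i 1 - axis j 1))"

lemma edge_matrix_insert:
  "edge_matrix {i, j} = outer (axis i 1 - axis j 1) (axis i 1 - axis j 1)"
proof -
  have "outer (axis j 1 - axis i 1) (axis j 1 - axis i 1)
      = outer (axis i 1 - axis j 1) (axis i 1 - axis j 1 :: real^'a)"
    by (simp add: outer_def vec_eq_iff algebra_simps)
  then show ?thesis
    unfolding edge_matrix_def by (intro the_equality) (auto simp: doubleton_eq_iff)
qed

definition laplacian :: "'v::finite set set \<Rightarrow> ('v set \<Rightarrow> real) \<Rightarrow> real^'v^'v" where
  "laplacian E w = (\<Sum>e\<in>E. w e *\<^sub>R edge_matrix e)"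

section \<open>The MaxCut SDP and its dual\<close>

text \<open>The all-ones vector is \<open>1 :: real^'n\<close>.\<close>

definition primal_feasible :: "real^'n^'n \<Rightarrow> bool" where
  "primal_feasible X \<longleftrightarrow> diag X = 1 \<and> psd X"

definition dual_feasible :: "real^'n^'n \<Rightarrow> real^'n \<Rightarrow> real^'n^'n \<Rightarrow> bool" where
  "dual_feasible C y S \<longleftrightarrow> S = Diag y - C \<and> psd S"

definition primal_optimal :: "real^'n^'n \<Rightarrow> real^'n^'n \<Rightarrow> bool" where
  "primal_optimal C X \<longleftrightarrow>
     primal_feasible X \<and> (\<forall>X'. primal_feasible X' \<longrightarrow> trace (C ** X') \<le> trace (C ** X))"

definition dual_optimal :: "real^'n^'n \<Rightarrow> real^'n \<Rightarrow> real^'n^'n \<Rightarrow> bool" where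
  "dual_optimal C y S \<longleftrightarrow>
     dual_feasible C y S \<and> (\<forall>y' S'. dual_feasible C y' S' \<longrightarrow> 1 \<bullet> y \<le> 1 \<bullet> y')"

definition strictly_complementary ::
  "real^'n^'n \<Rightarrow> real^'n^'n \<Rightarrow> real^'n \<Rightarrow> real^'n^'n \<Rightarrow> bool" where
  "strictly_complementary C X y S \<longleftrightarrow>
     primal_feasible X \<and> dual_feasible C y S \<and> X ** S = 0 \<and> pos_def (X + S)"

end

theory Submission
  imports Defs
begin

text \<open>
  Complementary slackness: since \<open>S\<^sup>* X\<^sup>* = 0\<close>, a feasible \<open>X\<close> is optimal iff \<open>S\<^sup>* X = 0\<close>, and
  a feasible \<open>(y, S)\<close> is optimal iff \<open>S X\<^sup>* = 0\<close>. Both \<open>1\<close> vectors are in the kernels of the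
  Laplacians, so the quadratic form of \<open>S\<^sup>*\<close> splits into a part on the means and a part on the
  centered vectors. As \<open>\<alpha> n\<^sub>G > \<mu>\<^sub>H\<close>, every vector in the kernel of \<open>S\<^sup>*\<close> is constant on \<open>H\<close>,
  with the opposite mean on \<open>G\<close>; together with \<open>diag X = 1\<close> this determines \<open>X\<close>. On the dual
  side, \<open>S X\<^sup>* = 0\<close> says \<open>Diag y s = C s\<close> for the vector \<open>s = -1 \<oplus> 1\<close>, which has no zero entry,
  and this determines \<open>y\<close>.
\<close>

section \<open>Symmetric and positive semidefinite matrices\<close>

lemma symmetric_inner_matrix:
  fixes A :: "real^'n^'n"
  assumes "transpose A = A"
  shows "x \<bullet> (A *v y) = (A *v x) \<bullet> y"
  by (metis assms dot_lmul_matrix transpose_matrix_vector)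

lemma quadratic_form_add:
  fixes A :: "real^'n^'n"
  assumes "transpose A = A"
  shows "(x + t *\<^sub>R y) \<bullet> (A *v (x + t *\<^sub>R y))
    = x \<bullet> (A *v x) + 2 * t * (x \<bullet> (A *v y)) + t\<^sup>2 * (y \<bullet> (A *v y))"
  using symmetric_inner_matrix[OF assms, of y x]
  by (simp add: matrix_vector_right_distrib matrix_vector_mult_scaleR inner_add_left
      inner_add_right inner_commute power2_eq_square algebra_simps)

text \<open>The form is nonnegative along the line \<open>x + t *\<^sub>R y\<close>, and a quadratic
  in \<open>t\<close> that is nowhere negative has nonpositive discriminant. If its leading
  coefficient is zero, the linear coefficient must vanish too.\<close>

lemma psd_Cauchy_Schwarz:
  assumes "psd A"
  shows "(x \<bullet> (A *v y))\<^sup>2 \<le> (x \<bullet> (A *v x)) * (y \<bullet> (A *v y))"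
proof -
  let ?a = "x \<bullet> (A *v x)" and ?b = "x \<bullet> (A *v y)" and ?c = "y \<bullet> (A *v y)"
  have q: "0 \<le> ?a + 2 * t * ?b + t\<^sup>2 * ?c" for t
    using assms by (simp add: psd_def flip: quadratic_form_add)
  show ?thesis
  proof (cases "?c = 0")
    case True
    have "?b = 0"
    proof (rule ccontr)
      assume "?b \<noteq> 0"
      then show False
        \<comment> \<open>This \<open>t\<close> makes the affine function
          \<open>?a + 2 * t * ?b\<close> equal to -1.\<close>
        using q[of "- (?a + 1) / (2 * ?b)"] True by (simp add: field_simps)
    qed
    then show ?thesis using True by simp
  next
    case False
    then have "0 < ?c" using assms by (auto simp: psd_def order_less_le)
    then show ?thesis
      \<comment> \<open>This \<open>t\<close> is the minimizer of the quadratic.\<close>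
      using q[of "- ?b / ?c"] by (simp add: field_simps power2_eq_square)
  qed
qed

text \<open>Cauchy-Schwarz for the pair \<open>A *v x\<close>, \<open>x\<close> bounds the fourth
  power of the norm of \<open>A *v x\<close> by zero.\<close>

lemma psd_kernel:
  assumes "psd A" and "x \<bullet> (A *v x) = 0"
  shows "A *v x = 0"
  using psd_Cauchy_Schwarz[OF assms(1), of "A *v x" x] assms(2) by simp

lemma axis_inner_matrix: "axis i 1 \<bullet> (A *v axis j 1) = (A::real^'n^'m) $ i $ j"
  by (simp add: matrix_vector_mult_basis column_def inner_axis')

lemma psd_diag_nonneg: "psd A \<Longrightarrow> 0 \<le> A $ i $ i"
  by (metis axis_inner_matrix psd_def)

lemma psd_entry_square_le: "psd A \<Longrightarrow> (A $ i $ j)\<^sup>2 \<le> A $ i $ i * A $ j $ j"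
  using psd_Cauchy_Schwarz[of A "axis i 1" "axis j 1"] by (simp add: axis_inner_matrix)

lemma matrix_mult_outer: "A ** outer x y = outer (A *v x) y"
  by (simp add: outer_def matrix_matrix_mult_def matrix_vector_mult_def vec_eq_iff
      sum_distrib_right mult.assoc)

lemma matrix_mult_scaleR_outer: "A ** (c *\<^sub>R outer x y) = c *\<^sub>R outer (A *v x) y"
  by (simp add: outer_def matrix_matrix_mult_def matrix_vector_mult_def vec_eq_iff
      sum_distrib_left sum_distrib_right algebra_simps)

lemma outer_mult_vector: "outer x y *v z = (y \<bullet> z) *\<^sub>R x"
  by (simp add: outer_def matrix_vector_mult_def vec_eq_iff inner_vec_def
      sum_distrib_left sum_distrib_right algebra_simps)

lemma transpose_outer: "transpose (outer x y) = outer y x"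
  by (simp add: outer_def transpose_def vec_eq_iff)

lemma psd_outer: "psd (outer x x)"
  by (simp add: psd_def transpose_outer outer_mult_vector inner_commute)

text \<open>
  Induction on the number of nonzero diagonal entries of \<open>X\<close>: if \<open>x\<close> is the \<open>i\<close>-th column and
  \<open>X\<^sub>i\<^sub>i > 0\<close>, then \<open>X - x x\<^sup>T / X\<^sub>i\<^sub>i\<close> is again positive semidefinite and has fewer of them.
\<close>

lemma trace_mult_psd:
  assumes "psd S" and "psd X"
  shows "0 \<le> trace (S ** X) \<and> (trace (S ** X) = 0 \<longrightarrow> S ** X = 0)"
  using assms(2)
proof (induction "card {i. X $ i $ i \<noteq> 0}" arbitrary: X rule: less_induct)
  case less
  show ?case
  proof (cases "\<forall>i. X $ i $ i = 0")
    case True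
    have "X = 0"
      using psd_entry_square_le[OF less.prems] True by (simp add: vec_eq_iff)
    then show ?thesis by (simp add: trace_def)
  next
    case False
    then obtain i where i: "X $ i $ i \<noteq> 0" by blast
    define d where "d = X $ i $ i"
    have d: "0 < d"
      using i psd_diag_nonneg[OF less.prems, of i] by (simp add: d_def)
    define x where "x = X *v axis i 1"
    define Y where "Y = X - (1 / d) *\<^sub>R outer x x"
    have sym: "transpose X = X" using less.prems by (simp add: psd_def)
    have xj: "x $ j = X $ j $ i" for j
      by (simp add: x_def matrix_vector_mult_basis column_def)
    have X: "X = Y + (1 / d) *\<^sub>R outer x x" by (simp add: Y_def)
    have "transpose Y = Y"
      using sym by (simp add: Y_def transpose_def outer_def vec_eq_iff)
    moreover have "0 \<le> z \<bullet> (Y *v z)" for z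
    proof -
      \<comment> \<open>Cauchy-Schwarz against the basis vector at \<open>i\<close> bounds the
        subtracted rank-one form by the form of \<open>X\<close>.\<close>
      have "(z \<bullet> x)\<^sup>2 \<le> (z \<bullet> (X *v z)) * d"
        using psd_Cauchy_Schwarz[OF less.prems, of z "axis i 1"]
        by (simp add: x_def d_def axis_inner_matrix)
      then have "(z \<bullet> x)\<^sup>2 / d \<le> z \<bullet> (X *v z)"
        using d by (simp add: field_simps)
      then show ?thesis
        by (simp add: Y_def matrix_vector_mult_diff_rdistrib outer_mult_vector inner_diff_right
            scaleR_matrix_vector_assoc[symmetric] inner_commute power2_eq_square)
    qed
    ultimately have Y: "psd Y" by (simp add: psd_def)
    have Yjj: "Y $ j $ j = X $ j $ j - (X $ j $ i)\<^sup>2 / d" for j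
      by (simp add: Y_def outer_def xj power2_eq_square)
    have "{j. Y $ j $ j \<noteq> 0} \<subset> {j. X $ j $ j \<noteq> 0}"
    proof
      show "{j. Y $ j $ j \<noteq> 0} \<subseteq> {j. X $ j $ j \<noteq> 0}"
      proof safe
        \<comment> \<open>A zero diagonal entry of \<open>X\<close> forces
          \<open>X $ j $ i = 0\<close>, so the subtraction leaves that diagonal entry zero.\<close>
        fix j assume "X $ j $ j = 0" and "Y $ j $ j \<noteq> 0"
        then show False
          using psd_entry_square_le[OF less.prems, of j i] by (simp add: Yjj)
      qed
      have "Y $ i $ i = 0"
        using d by (simp add: Yjj power2_eq_square flip: d_def)
      then show "{j. Y $ j $ j \<noteq> 0} \<noteq> {j. X $ j $ j \<noteq> 0}" using i by blast
    qed
    then have "card {j. Y $ j $ j \<noteq> 0} < card {j. X $ j $ j \<noteq> 0}"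
      by (simp add: psubset_card_mono)
    note IH = less.hyps[OF this Y]
    have SX: "S ** X = S ** Y + (1 / d) *\<^sub>R outer (S *v x) x"
      by (subst X) (simp only: matrix_add_ldistrib matrix_mult_scaleR_outer)
    have tr: "trace (S ** X) = trace (S ** Y) + (x \<bullet> (S *v x)) / d"
      unfolding SX trace_add
      by (simp add: trace_def outer_def inner_vec_def mult.commute flip: sum_divide_distrib)
    have nn: "0 \<le> (x \<bullet> (S *v x)) / d"
      using assms(1) d by (simp add: psd_def)
    show ?thesis
    proof (intro conjI impI)
      show "0 \<le> trace (S ** X)" using tr nn IH by simp
    next
      assume "trace (S ** X) = 0"
      then have "trace (S ** Y) = 0" "x \<bullet> (S *v x) = 0"
        using tr nn IH d by (auto simp: add_nonneg_eq_0_iff)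
      then show "S ** X = 0"
        using IH psd_kernel[OF assms(1)] SX by (simp add: outer_def vec_eq_iff)
    qed
  qed
qed

section \<open>The largest eigenvalue\<close>

text \<open>Eigenvectors of a symmetric matrix for distinct eigenvalues are orthogonal, hence
  independent, so choosing one for each eigenvalue gives a finite set.\<close>

lemma finite_eigenvalues:
  fixes A :: "real^'n^'n"
  assumes "transpose A = A"
  shows "finite {l. \<exists>v. eigenvector A v l}"
proof -
  define f where "f l = (SOME v. eigenvector A v l)" for l
  let ?L = "{l. \<exists>v. eigenvector A v l}"
  have f: "eigenvector A (f l) l" if "l \<in> ?L" for l
    using that unfolding f_def by (auto intro: someI)
  have orth: "f l \<bullet> f m = 0" if "l \<in> ?L" "m \<in> ?L" "l \<noteq> m" for l m
  proof -
    have "m * (f l \<bullet> f m) = l * (f l \<bullet> f m)"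
      using symmetric_inner_matrix[OF assms, of "f l" "f m"] f[OF that(1)] f[OF that(2)]
      by (simp add: eigenvector_def)
    then show ?thesis using that(3) by simp
  qed
  have nz: "f l \<noteq> 0" if "l \<in> ?L" for l using f[OF that] by (simp add: eigenvector_def)
  have "inj_on f ?L"
    by (rule inj_onI) (metis inner_eq_zero_iff nz orth)
  moreover have "finite (f ` ?L)"
  proof (rule finiteI_independent, rule pairwise_orthogonal_independent)
    show "pairwise orthogonal (f ` ?L)"
      unfolding pairwise_def orthogonal_def by (auto intro!: orth)
    show "0 \<notin> f ` ?L" using nz by (metis imageE)
  qed
  ultimately show ?thesis by (rule finite_imageD[rotated])
qed

text \<open>
  A maximizer \<open>v\<close> of the quadratic form on the unit sphere, with maximum \<open>M\<close>, lies in the kernel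
  of the positive semidefinite matrix \<open>M I - A\<close>.
\<close>

lemma lambda_max_Rayleigh:
  fixes A :: "real^'n^'n"
  assumes "transpose A = A"
  shows "(\<exists>v. eigenvector A v (lambda_max A)) \<and> (\<forall>x. x \<bullet> (A *v x) \<le> lambda_max A * (x \<bullet> x))"
proof -
  let ?q = "\<lambda>x. x \<bullet> (A *v x)"
  have "continuous_on (sphere 0 1) ?q"
    by (intro continuous_intros linear_continuous_on linear_conv_bounded_linear[THEN iffD1]
        matrix_vector_mul_linear)
  \<comment> \<open>Any basis vector shows that the sphere is nonempty.\<close>
  moreover have "axis undefined 1 \<in> (sphere 0 1 :: (real^'n) set)"
    by simp
  ultimately obtain v where v: "v \<in> sphere 0 1" "\<And>x. x \<in> sphere 0 1 \<Longrightarrow> ?q x \<le> ?q v"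
    using continuous_attains_sup[of "sphere 0 1" ?q] by auto
  define M where "M = ?q v"
  have le: "?q x \<le> M * (x \<bullet> x)" for x
  proof (cases "x = 0")
    case False
    then have "?q (x /\<^sub>R norm x) \<le> M"
      unfolding M_def by (intro v(2)) simp
    then show ?thesis
      using False by (simp add: matrix_vector_mult_scaleR field_simps dot_square_norm power2_eq_square)
  qed simp
  have sub: "(M *\<^sub>R mat 1 - A) *v x = M *\<^sub>R x - A *v x" for x
    by (simp add: matrix_vector_mult_diff_rdistrib scaleR_matrix_vector_assoc[symmetric])
  have "transpose (M *\<^sub>R mat 1 - A) = M *\<^sub>R mat 1 - A"
    using assms by (simp add: transpose_def vec_eq_iff mat_def)
  then have "psd (M *\<^sub>R mat 1 - A)"
    unfolding psd_def sub using le by (simp add: inner_diff_right)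
  moreover have "v \<bullet> ((M *\<^sub>R mat 1 - A) *v v) = 0"
    using v(1) unfolding sub by (simp add: inner_diff_right M_def dot_square_norm)
  ultimately have "A *v v = M *\<^sub>R v"
    using psd_kernel sub by (metis eq_iff_diff_eq_0)
  then have ev: "eigenvector A v M"
    using v(1) by (auto simp: eigenvector_def)
  have "lambda_max A = M"
    unfolding lambda_max_def
  proof (rule Max_eqI)
    show "finite {l. \<exists>v. eigenvector A v l}" by (rule finite_eigenvalues[OF assms])
    show "M \<in> {l. \<exists>v. eigenvector A v l}" using ev by blast
    fix l assume "l \<in> {l. \<exists>v. eigenvector A v l}"
    then obtain x where x: "x \<noteq> 0" "A *v x = l *\<^sub>R x" by (auto simp: eigenvector_def)
    then show "l \<le> M" using le[of x] by simp
  qed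
  then show ?thesis using ev le by blast
qed

lemma lambda_max_ge:
  fixes A :: "real^'n^'n"
  assumes "transpose A = A" and "eigenvector A v l"
  shows "l \<le> lambda_max A"
  unfolding lambda_max_def using finite_eigenvalues[OF assms(1)] assms(2) by (auto intro: Max_ge)

section \<open>Duality\<close>

lemma trace_Diag_mult: "trace (Diag y ** X) = y \<bullet> diag X"
proof -
  have "(Diag y ** X) $ i $ i = y $ i * X $ i $ i" for i
    by (simp add: Diag_def matrix_matrix_mult_def if_distrib[where f = "\<lambda>x. x * _"] cong: if_cong)
  then show ?thesis by (simp add: trace_def diag_def inner_vec_def)
qed

text \<open>The constraint \<open>diag X = 1\<close> turns the trace of \<open>Diag y ** X\<close>
  into \<open>1 \<bullet> y\<close>. Weak duality then follows from
  \<open>trace_mult_psd\<close>.\<close>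

lemma duality_gap:
  assumes "primal_feasible X" and "dual_feasible C y S"
  shows "1 \<bullet> y - trace (C ** X) = trace (S ** X)"
proof -
  have "S ** X = Diag y ** X - C ** X"
    using assms(2) by (simp add: dual_feasible_def matrix_matrix_mult_def vec_eq_iff
        sum_subtractf left_diff_distrib)
  then show ?thesis
    using assms(1) by (simp add: trace_sub trace_Diag_mult primal_feasible_def inner_commute)
qed

text \<open>The reference pair has gap zero, so optimality of either candidate means a zero gap
  against the opposite half of the pair. By \<open>trace_mult_psd\<close> this is a vanishing
  product.\<close>

lemma optimal_iff_complementary:
  fixes C X0 S0 X S :: "real^'n^'n" and y0 y :: "real^'n"
  assumes X0: "primal_feasible X0" and S0: "dual_feasible C y0 S0" and "S0 ** X0 = 0"
  shows primal_optimal_iff: "primal_optimal C X \<longleftrightarrow> primal_feasible X \<and> S0 ** X = 0"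
    and dual_optimal_iff: "dual_optimal C y S \<longleftrightarrow> dual_feasible C y S \<and> S ** X0 = 0"
proof -
  have tr0: "trace (0 :: real^'n^'n) = 0" by (simp add: trace_def)
  have weak: "0 \<le> trace (S ** X) \<and> (trace (S ** X) = 0 \<longrightarrow> S ** X = 0)"
    if "primal_feasible X" "dual_feasible C y S" for X y and S :: "real^'n^'n"
    using that by (intro trace_mult_psd) (auto simp: primal_feasible_def dual_feasible_def)
  have gap0: "1 \<bullet> y0 = trace (C ** X0)"
    using duality_gap[OF X0 S0] unfolding assms(3) tr0 by simp
  show "primal_optimal C X \<longleftrightarrow> primal_feasible X \<and> S0 ** X = 0"
  proof
    assume opt: "primal_optimal C X"
    then have X: "primal_feasible X" and "trace (C ** X0) \<le> trace (C ** X)"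
      using X0 by (auto simp: primal_optimal_def)
    then have "trace (S0 ** X) \<le> 0" using duality_gap[OF X S0] gap0 by simp
    then show "primal_feasible X \<and> S0 ** X = 0" using X weak[OF X S0] by auto
  next
    assume X: "primal_feasible X \<and> S0 ** X = 0"
    show "primal_optimal C X"
      unfolding primal_optimal_def
    proof (intro conjI allI impI)
      fix X' :: "real^'n^'n" assume X': "primal_feasible X'"
      show "trace (C ** X') \<le> trace (C ** X)"
        using duality_gap[OF X' S0] duality_gap[of X C y0 S0] weak[OF X' S0] X S0 tr0 by simp
    qed (use X in simp)
  qed
  show "dual_optimal C y S \<longleftrightarrow> dual_feasible C y S \<and> S ** X0 = 0"
  proof
    assume opt: "dual_optimal C y S"
    then have S: "dual_feasible C y S" and "1 \<bullet> y \<le> 1 \<bullet> y0"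
      using S0 by (auto simp: dual_optimal_def)
    then have "trace (S ** X0) \<le> 0" using duality_gap[OF X0 S] gap0 by simp
    then show "dual_feasible C y S \<and> S ** X0 = 0" using S weak[OF X0 S] by auto
  next
    assume S: "dual_feasible C y S \<and> S ** X0 = 0"
    show "dual_optimal C y S"
      unfolding dual_optimal_def
    proof (intro conjI allI impI)
      fix y' and S' :: "real^'n^'n" assume S': "dual_feasible C y' S'"
      show "1 \<bullet> y \<le> 1 \<bullet> y'"
        using duality_gap[OF X0 S'] duality_gap[of X0 C y S] weak[OF X0 S'] S X0 tr0 by simp
    qed (use S in simp)
  qed
qed

section \<open>Block matrices\<close>

lemma dsum_Inl [simp]: "(u \<oplus>\<^sub>v v) $ Inl i = u $ i"
  and dsum_Inr [simp]: "(u \<oplus>\<^sub>v v) $ Inr j = v $ j"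
  by (simp_all add: dsum_def)

lemma vec_sum_eq_iff:
  "x = y \<longleftrightarrow> (\<forall>i. x $ Inl i = y $ Inl i) \<and> (\<forall>j. x $ Inr j = y $ Inr j)"
  by (metis obj_sumE vec_eq_iff)

lemma dsum_exhaust:
  obtains u v where "x = u \<oplus>\<^sub>v v"
proof
  show "x = (\<chi> i. x $ Inl i) \<oplus>\<^sub>v (\<chi> j. x $ Inr j)" by (simp add: vec_sum_eq_iff)
qed

lemma sum_UNIV_Plus:
  fixes f :: "'a::finite + 'b::finite \<Rightarrow> 'c::comm_monoid_add"
  shows "sum f UNIV = (\<Sum>i\<in>UNIV. f (Inl i)) + (\<Sum>j\<in>UNIV. f (Inr j))"
  using sum.Plus[of "UNIV :: 'a set" "UNIV :: 'b set" f] by simp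

lemma inner_dsum: "(u \<oplus>\<^sub>v v) \<bullet> (u' \<oplus>\<^sub>v v') = u \<bullet> u' + v \<bullet> v'"
  by (simp add: inner_vec_def sum_UNIV_Plus)

lemma block_matrix_index [simp]:
  "block_matrix A B C D $ Inl i = A $ i \<oplus>\<^sub>v B $ i"
  "block_matrix A B C D $ Inr j = C $ j \<oplus>\<^sub>v D $ j"
  by (simp_all add: block_matrix_def)

lemma block_matrix_mult_dsum:
  "block_matrix A B C D *v (u \<oplus>\<^sub>v v) = (A *v u + B *v v) \<oplus>\<^sub>v (C *v u + D *v v)"
  by (simp add: vec_sum_eq_iff matrix_vector_mult_def sum_UNIV_Plus)

section \<open>Laplacians\<close>

lemma simple_graph_edgeE:
  assumes "simple_graph E" and "e \<in> E"
  obtains i j where "e = {i, j}" "i \<noteq> j"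
  using assms unfolding simple_graph_def card_2_iff by blast

lemma inner_one_one: "(1 :: real^'n) \<bullet> 1 = real CARD('n)"
  by (simp add: inner_vec_def)

lemma one_vec_neq_zero: "(1 :: real^'n) \<noteq> 0"
  by (simp add: vec_eq_iff)

lemma transpose_laplacian:
  assumes "simple_graph E"
  shows "transpose (laplacian E w) = laplacian E w"
proof -
  have "edge_matrix e $ i $ j = edge_matrix e $ j $ i" if "e \<in> E" for e i j
    by (rule simple_graph_edgeE[OF assms that]) (simp add: edge_matrix_insert outer_def mult.commute)
  then show ?thesis
    by (simp add: laplacian_def transpose_def vec_eq_iff)
qed

lemma laplacian_mult_one:
  assumes "simple_graph E"
  shows "laplacian E w *v 1 = 0"
proof -
  have "edge_matrix e *v 1 = 0" if "e \<in> E" for e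
    by (rule simple_graph_edgeE[OF assms that])
      (simp add: edge_matrix_insert outer_mult_vector inner_diff_left inner_axis')
  moreover have "laplacian E w *v 1 = (\<Sum>e\<in>E. w e *\<^sub>R (edge_matrix e *v 1))"
    unfolding laplacian_def
    by (induction E rule: infinite_finite_induct)
      (simp_all add: matrix_vector_mult_add_rdistrib scaleR_matrix_vector_assoc)
  ultimately show ?thesis by simp
qed

lemma edge_matrix_image_Inl:
  assumes "simple_graph E" and "e \<in> E"
  shows "edge_matrix (Inl ` e) = block_matrix (edge_matrix e) 0 0 0"
  by (rule simple_graph_edgeE[OF assms])
    (simp add: edge_matrix_insert outer_def vec_sum_eq_iff axis_def vec_eq_iff)

lemma edge_matrix_image_Inr:
  assumes "simple_graph E" and "e \<in> E"
  shows "edge_matrix (Inr ` e) = block_matrix 0 0 0 (edge_matrix e)"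
  by (rule simple_graph_edgeE[OF assms])
    (simp add: edge_matrix_insert outer_def vec_sum_eq_iff axis_def vec_eq_iff)

text \<open>This is the Laplacian of the complete bipartite graph with unit weights, with the
  degrees in the diagonal blocks.\<close>

lemma sum_edge_matrix_cross:
  "(\<Sum>(v, u)\<in>UNIV. edge_matrix {Inl v :: 'g::finite + 'h::finite, Inr u})
    = block_matrix (real CARD('h) *\<^sub>R mat 1) (- outer 1 1) (- outer 1 1) (real CARD('g) *\<^sub>R mat 1)"
    (is "?M = _")
proof -
  let ?d = "\<lambda>i j. if i = j then 1 else 0 :: real"
  \<comment> \<open>In each block, one of the two deltas in each factor vanishes, which leaves the
    sums evaluated below.\<close>
  have M: "?M $ k $ l = (\<Sum>v\<in>UNIV. \<Sum>u\<in>UNIV.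
      (?d k (Inl v) - ?d k (Inr u)) * (?d l (Inl v) - ?d l (Inr u)))" for k l
    unfolding UNIV_Times_UNIV[symmetric] sum.cartesian_product[symmetric]
    by (simp only: edge_matrix_insert outer_def axis_def sum_component vec_lambda_beta
        vector_minus_component)
  have delta: "(\<Sum>v\<in>UNIV. ?d i v * f v) = f i" for i :: "'z::finite" and f
    by (simp add: if_distrib[where f = "\<lambda>x. x * _"] cong: if_cong)
  have "?M $ Inl i $ Inl j = (\<Sum>v\<in>UNIV. ?d i v * (real CARD('h) * ?d j v))" for i j
    unfolding M by (intro sum.cong) simp_all
  moreover have "?M $ Inr i $ Inr j = (\<Sum>v::'g\<in>UNIV. \<Sum>u\<in>UNIV. ?d i u * ?d j u)" for i j
    unfolding M by (intro sum.cong) simp_all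
  moreover have "?M $ Inl i $ Inr j = (\<Sum>v\<in>UNIV. ?d i v * (\<Sum>u\<in>UNIV. ?d j u * - 1))" for i j
    unfolding M sum_distrib_left by (intro sum.cong) simp_all
  moreover have "?M $ Inr i $ Inl j = (\<Sum>v\<in>UNIV. ?d j v * (\<Sum>u\<in>UNIV. ?d i u * - 1))" for i j
    unfolding M sum_distrib_left by (intro sum.cong) simp_all
  ultimately show ?thesis
    unfolding delta by (auto simp: vec_sum_eq_iff vec_eq_iff mat_def outer_def)
qed

text \<open>
  The lemma \<open>cosum_weight_simps\<close> only covers the case of two vertex types that coincide, because
  it shares the variable \<open>e\<close> between its equations.
\<close>

lemma cosum_weight_Inl: "e \<noteq> {} \<Longrightarrow> cosum_weight wG wH \<alpha> (Inl ` e) = wG e"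
  and cosum_weight_Inr: "e' \<noteq> {} \<Longrightarrow> cosum_weight wG wH \<alpha> (Inr ` e') = wH e'"
  and cosum_weight_cross: "cosum_weight wG wH \<alpha> {Inl v, Inr u} = \<alpha>"
  by (auto simp: cosum_weight_def inj_vimage_image_eq)

text \<open>The edge set splits into three disjoint families. Edges of each graph contribute to its
  own diagonal block only, and the cross edges add \<alpha> times the bipartite Laplacian.\<close>

lemma laplacian_cosum:
  fixes EG :: "'g::finite set set" and EH :: "'h::finite set set"
  assumes G: "simple_graph EG" and H: "simple_graph EH"
  shows "laplacian (cosum EG EH) (cosum_weight wG wH \<alpha>)
    = block_matrix (laplacian EG wG + (\<alpha> * real CARD('h)) *\<^sub>R mat 1) (- \<alpha> *\<^sub>R outer 1 1)
        (- \<alpha> *\<^sub>R outer 1 1) (laplacian EH wH + (\<alpha> * real CARD('g)) *\<^sub>R mat 1)"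
proof -
  let ?w = "cosum_weight wG wH \<alpha>"
  let ?f = "\<lambda>e. ?w e *\<^sub>R edge_matrix e"
  let ?A = "(\<lambda>e. Inl ` e) ` EG :: ('g + 'h) set set"
  let ?B = "(\<lambda>e. Inr ` e) ` EH :: ('g + 'h) set set"
  let ?K = "(\<lambda>(v, u). {Inl v, Inr u}) ` UNIV :: ('g + 'h) set set"
  have ne: "e \<noteq> {}" if "e \<in> EG" for e using G that by (auto elim: simple_graph_edgeE)
  have ne': "e \<noteq> {}" if "e \<in> EH" for e using H that by (auto elim: simple_graph_edgeE)
  have cosum: "cosum EG EH = ?A \<union> ?B \<union> ?K" by (auto simp: cosum_def)
  have A: "e \<noteq> {} \<and> e \<subseteq> range Inl" if "e \<in> ?A" for e using that ne by auto
  have B: "e \<subseteq> range Inr" if "e \<in> ?B" for e using that by auto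
  have K: "\<not> e \<subseteq> range Inl \<and> \<not> e \<subseteq> range Inr" if "e \<in> ?K" for e using that by auto
  \<comment> \<open>Nonemptiness of edges matters, as the empty set lies in both ranges.\<close>
  have "\<not> (e \<noteq> {} \<and> e \<subseteq> range Inl \<and> e \<subseteq> range Inr)" for e :: "('g + 'h) set" by auto
  then have disj: "?A \<inter> ?B = {}" "(?A \<union> ?B) \<inter> ?K = {}"
    unfolding disjoint_iff Un_iff using A B K by meson+
  have "sum ?f ?A = (\<Sum>e\<in>EG. ?f (Inl ` e))"
    by (subst sum.reindex) (auto simp: inj_on_def inj_image_eq_iff)
  also have "\<dots> = (\<Sum>e\<in>EG. wG e *\<^sub>R block_matrix (edge_matrix e) 0 0 0)"
    using ne by (intro sum.cong) (simp_all add: cosum_weight_Inl edge_matrix_image_Inl[OF G])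
  also have "\<dots> = block_matrix (laplacian EG wG) 0 0 0"
    by (simp add: vec_sum_eq_iff laplacian_def)
  finally have A: "sum ?f ?A = block_matrix (laplacian EG wG) 0 0 0" .
  have "sum ?f ?B = (\<Sum>e\<in>EH. ?f (Inr ` e))"
    by (subst sum.reindex) (auto simp: inj_on_def inj_image_eq_iff)
  also have "\<dots> = (\<Sum>e\<in>EH. wH e *\<^sub>R block_matrix 0 0 0 (edge_matrix e))"
    using ne' by (intro sum.cong) (simp_all add: cosum_weight_Inr edge_matrix_image_Inr[OF H])
  also have "\<dots> = block_matrix 0 0 0 (laplacian EH wH)"
    by (simp add: vec_sum_eq_iff laplacian_def)
  finally have B: "sum ?f ?B = block_matrix 0 0 0 (laplacian EH wH)" .
  have "sum ?f ?K = (\<Sum>(v, u)\<in>UNIV. \<alpha> *\<^sub>R edge_matrix {Inl v :: 'g + 'h, Inr u})"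
    by (subst sum.reindex)
      (auto simp: inj_on_def doubleton_eq_iff cosum_weight_cross intro!: sum.cong)
  also have "\<dots> = \<alpha> *\<^sub>R (\<Sum>(v, u)\<in>UNIV. edge_matrix {Inl v :: 'g + 'h, Inr u})"
    by (simp add: scaleR_sum_right case_prod_unfold)
  finally have K: "sum ?f ?K = \<alpha> *\<^sub>R block_matrix (real CARD('h) *\<^sub>R mat 1) (- outer 1 1)
      (- outer 1 1) (real CARD('g) *\<^sub>R mat 1)"
    unfolding sum_edge_matrix_cross .
  have "laplacian (cosum EG EH) ?w = sum ?f ?A + sum ?f ?B + sum ?f ?K"
    unfolding laplacian_def cosum using disj by (simp add: sum.union_disjoint)
  then show ?thesis
    unfolding A B K by (simp add: vec_sum_eq_iff)
qed

section \<open>The dual optimal matrix\<close>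

text \<open>Here \<open>a\<close> is the mean of \<open>x\<close>. The centered vector is orthogonal
  to \<open>1\<close>, and \<open>L\<close> is symmetric and annihilates \<open>1\<close>, so all
  mixed terms vanish.\<close>

lemma quadratic_form_centered:
  fixes L :: "real^'n^'n" and x :: "real^'n" and m :: real
  assumes "transpose L = L" and "L *v 1 = 0"
  defines "a \<equiv> (1 \<bullet> x) / real CARD('n)"
  shows "m * (x \<bullet> x) - x \<bullet> (L *v x) = m * (real CARD('n) * a\<^sup>2)
    + (m * ((x - a *\<^sub>R 1) \<bullet> (x - a *\<^sub>R 1)) - (x - a *\<^sub>R 1) \<bullet> (L *v (x - a *\<^sub>R 1)))"
proof -
  have a: "x \<bullet> 1 = real CARD('n) * a" by (simp add: a_def inner_commute)
  have L: "L *v (x - a *\<^sub>R 1) = L *v x"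
    using assms(2) by (simp add: matrix_vector_mult_diff_distrib matrix_vector_mult_scaleR)
  have "1 \<bullet> (L *v x) = 0"
    using symmetric_inner_matrix[OF assms(1), of 1 x] assms(2) by simp
  then show ?thesis
    unfolding L using a
    by (simp add: inner_diff_left inner_diff_right inner_one_one inner_commute[of 1 x]
        power2_eq_square algebra_simps)
qed

text \<open>
  With \<open>a\<close> and \<open>b\<close> the means of \<open>g\<close> and \<open>h\<close>, the quadratic form of the matrix at \<open>g \<oplus> h\<close> is
  \<open>n\<^sub>G \<mu>\<^sub>G (a + b)\<^sup>2\<close> plus the forms of the diagonal blocks at \<open>g - a 1\<close> and \<open>h - b 1\<close>.
  The condition \<open>\<mu>\<^sub>G = \<alpha> n\<^sub>H\<close> makes the first term a perfect square.
\<close>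

lemma dual_matrix_form:
  fixes LG :: "real^'g^'g" and LH :: "real^'h^'h" and g :: "real^'g" and h :: "real^'h"
  assumes G: "transpose LG = LG" "LG *v 1 = 0" and H: "transpose LH = LH" "LH *v 1 = 0"
    and \<mu>: "\<mu> = \<alpha> * real CARD('h)"
  defines "a \<equiv> (1 \<bullet> g) / real CARD('g)" and "b \<equiv> (1 \<bullet> h) / real CARD('h)"
    and "S \<equiv> block_matrix (\<mu> *\<^sub>R mat 1 - LG) (\<alpha> *\<^sub>R outer 1 1)
      (\<alpha> *\<^sub>R outer 1 1) ((\<alpha> * real CARD('g)) *\<^sub>R mat 1 - LH)"
  shows "(g \<oplus>\<^sub>v h) \<bullet> (S *v (g \<oplus>\<^sub>v h)) = real CARD('g) * \<mu> * (a + b)\<^sup>2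
    + (\<mu> * ((g - a *\<^sub>R 1) \<bullet> (g - a *\<^sub>R 1)) - (g - a *\<^sub>R 1) \<bullet> (LG *v (g - a *\<^sub>R 1)))
    + (\<alpha> * real CARD('g) * ((h - b *\<^sub>R 1) \<bullet> (h - b *\<^sub>R 1)) - (h - b *\<^sub>R 1) \<bullet> (LH *v (h - b *\<^sub>R 1)))"
    (is "_ = _ + ?G + ?H")
proof -
  let ?nG = "real CARD('g)" and ?nH = "real CARD('h)"
  have ab: "1 \<bullet> g = ?nG * a" "1 \<bullet> h = ?nH * b" by (simp_all add: a_def b_def)
  have "(g \<oplus>\<^sub>v h) \<bullet> (S *v (g \<oplus>\<^sub>v h)) = (\<mu> * (g \<bullet> g) - g \<bullet> (LG *v g))
      + (\<alpha> * ?nG * (h \<bullet> h) - h \<bullet> (LH *v h)) + 2 * \<alpha> * (1 \<bullet> g) * (1 \<bullet> h)"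
    by (simp add: S_def block_matrix_mult_dsum inner_dsum matrix_vector_mult_diff_rdistrib
        scaleR_matrix_vector_assoc[symmetric] outer_mult_vector inner_add_right inner_diff_right
        inner_commute[of _ 1])
  also have "\<dots> = (\<mu> * (?nG * a\<^sup>2) + ?G) + (\<alpha> * ?nG * (?nH * b\<^sup>2) + ?H)
      + 2 * \<alpha> * (?nG * a) * (?nH * b)"
    using quadratic_form_centered[OF G, of \<mu> g] quadratic_form_centered[OF H, of "\<alpha> * ?nG" h]
    by (simp add: ab flip: a_def b_def)
  also have "\<dots> = ?nG * \<mu> * (a + b)\<^sup>2 + ?G + ?H"
    by (simp add: \<mu> power2_eq_square algebra_simps)
  finally show ?thesis .
qed

text \<open>All three summands in \<open>dual_matrix_form\<close> are nonnegative and so vanish on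
  the kernel. The first gives opposite means, and the strict bound \<open>less\<close> makes the
  third force constancy on \<open>'h\<close>. The second also vanishes on top eigenvectors of
  \<open>LG\<close>, so on \<open>'g\<close> only the sum is recorded.\<close>

lemma dual_matrix_psd_kernel:
  fixes LG :: "real^'g^'g" and LH :: "real^'h^'h"
  assumes G: "transpose LG = LG" "LG *v 1 = 0" and H: "transpose LH = LH" "LH *v 1 = 0"
    and \<mu>: "\<mu> = \<alpha> * real CARD('h)" "\<mu> = lambda_max LG" "0 < \<mu>"
    and less: "lambda_max LH < \<alpha> * real CARD('g)"
  defines "S \<equiv> block_matrix (\<mu> *\<^sub>R mat 1 - LG) (\<alpha> *\<^sub>R outer 1 1)
      (\<alpha> *\<^sub>R outer 1 1) ((\<alpha> * real CARD('g)) *\<^sub>R mat 1 - LH)"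
  shows "psd S"
    and "S *v x = 0 \<Longrightarrow> \<exists>b. (\<forall>u. x $ Inr u = b) \<and> (\<Sum>v\<in>UNIV. x $ Inl v) = - (real CARD('g) * b)"
proof -
  let ?nG = "real CARD('g)" and ?nH = "real CARD('h)"
  let ?P = "\<lambda>g. \<mu> * (g \<bullet> g) - g \<bullet> (LG *v g)"
  let ?Q = "\<lambda>h. \<alpha> * ?nG * (h \<bullet> h) - h \<bullet> (LH *v h)"
  have P: "0 \<le> ?P g" for g
    using lambda_max_Rayleigh[OF G(1)] \<mu>(2) by auto
  have Q: "(\<alpha> * ?nG - lambda_max LH) * (h \<bullet> h) \<le> ?Q h" for h
    using lambda_max_Rayleigh[OF H(1)] by (auto simp: left_diff_distrib)
  have Q0: "0 \<le> ?Q h" for h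
    using Q[of h] less by (meson diff_ge_0_iff_ge inner_ge_zero less_imp_le mult_nonneg_nonneg order_trans)
  note form = dual_matrix_form[OF G H \<mu>(1), folded S_def]
  have "transpose S = S"
    using G(1) H(1)
    by (simp add: S_def transpose_def vec_sum_eq_iff vec_eq_iff mat_def outer_def)
  moreover have "0 \<le> y \<bullet> (S *v y)" for y
  proof -
    obtain g h where y: "y = g \<oplus>\<^sub>v h" by (rule dsum_exhaust)
    show ?thesis
      unfolding y form by (intro add_nonneg_nonneg P Q0) (use \<mu>(3) in simp)
  qed
  ultimately show "psd S" by (simp add: psd_def)
  assume "S *v x = 0"
  obtain g h where x: "x = g \<oplus>\<^sub>v h" by (rule dsum_exhaust)
  define a where "a = (1 \<bullet> g) / ?nG"
  define b where "b = (1 \<bullet> h) / ?nH"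
  have "?nG * \<mu> * (a + b)\<^sup>2 + ?P (g - a *\<^sub>R 1) + ?Q (h - b *\<^sub>R 1) = 0"
    using form[of g h] \<open>S *v x = 0\<close> by (simp add: a_def b_def flip: x)
  moreover have "0 \<le> ?nG * \<mu> * (a + b)\<^sup>2" using \<mu>(3) by simp
  ultimately have "?nG * \<mu> * (a + b)\<^sup>2 = 0" and "?Q (h - b *\<^sub>R 1) = 0"
    using P[of "g - a *\<^sub>R 1"] Q0[of "h - b *\<^sub>R 1"] by linarith+
  then have ab: "a = - b" and "(\<alpha> * ?nG - lambda_max LH) * ((h - b *\<^sub>R 1) \<bullet> (h - b *\<^sub>R 1)) \<le> 0"
    using \<mu>(3) Q[of "h - b *\<^sub>R 1"] by auto
  then have "(h - b *\<^sub>R 1) \<bullet> (h - b *\<^sub>R 1) \<le> 0"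
    using less by (simp add: mult_le_0_iff)
  then have h: "h = b *\<^sub>R 1"
    by (metis eq_iff_diff_eq_0 inner_eq_zero_iff inner_ge_zero order_antisym)
  have "(\<Sum>v\<in>UNIV. g $ v) = ?nG * a" by (simp add: a_def inner_vec_def)
  then show "\<exists>b. (\<forall>u. x $ Inr u = b) \<and> (\<Sum>v\<in>UNIV. x $ Inl v) = - (?nG * b)"
    using h ab by (intro exI[of _ b]) (simp add: x)
qed

section \<open>Uniqueness of the primal solution\<close>

text \<open>
  The column of a vertex of \<open>H\<close> is constant \<open>1\<close> on \<open>H\<close> by the diagonal constraint, so its mean
  on \<open>G\<close> is \<open>-1\<close>. Since all entries of \<open>X\<close> lie in \<open>[-1, 1]\<close>, it is constant \<open>-1\<close> on \<open>G\<close>. The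
  columns of the vertices of \<open>G\<close> then follow by symmetry and the same averaging.
\<close>

lemma primal_feasible_eq_outer:
  fixes X :: "real^('g::finite + 'h::finite)^('g + 'h)"
  assumes "primal_feasible X"
    and ker: "\<And>k. \<exists>b. (\<forall>u. X $ Inr u $ k = b) \<and>
      (\<Sum>v\<in>UNIV. X $ Inl v $ k) = - (real CARD('g) * b)"
  shows "X = outer (- 1 \<oplus>\<^sub>v 1) (- 1 \<oplus>\<^sub>v 1)"
proof -
  have psd: "psd X" using assms(1) by (simp add: primal_feasible_def)
  have diag: "X $ k $ k = 1" for k
    using assms(1) by (simp add: primal_feasible_def diag_def vec_eq_iff)
  have sym: "X $ k $ l = X $ l $ k" for k l
    using psd unfolding psd_def transpose_def vec_eq_iff by auto
  have "\<bar>X $ k $ l\<bar> \<le> 1" for k l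
    using psd_entry_square_le[OF psd, of k l] by (simp add: diag abs_square_le_1)
  then have bounds: "-1 \<le> X $ k $ l" "X $ k $ l \<le> 1" for k l
    by (auto simp: abs_le_iff)
  have HH: "X $ Inr u $ Inr u' = 1" for u u'
    using ker[of "Inr u'"] diag by metis
  have GH: "X $ Inl v $ Inr u = -1" for v u
  proof -
    have "(\<Sum>v\<in>UNIV. X $ Inl v $ Inr u) = - real CARD('g)"
      using ker[of "Inr u"] HH by auto
    \<comment> \<open>After subtracting the lower bound -1, the entries are nonnegative with sum
      zero.\<close>
    then have "(\<Sum>v\<in>UNIV. X $ Inl v $ Inr u - (-1)) = 0"
      by (simp only: sum_subtractf) simp
    then have "X $ Inl v $ Inr u - (-1) = 0"
      using bounds by (subst (asm) sum_nonneg_eq_0_iff) (simp_all only: diff_ge_0_iff_ge finite UNIV_I ball_UNIV)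
    then show ?thesis by simp
  qed
  have GG: "X $ Inl v $ Inl v' = 1" for v v'
  proof -
    \<comment> \<open>By \<open>GH\<close> and symmetry, the constant \<open>b\<close> of this
      column is -1.\<close>
    have "(\<Sum>v\<in>UNIV. X $ Inl v $ Inl v') = real CARD('g)"
      using ker[of "Inl v'"] GH sym by auto
    then have "(\<Sum>v\<in>UNIV. 1 - X $ Inl v $ Inl v') = 0"
      by (simp add: sum_subtractf)
    then have "1 - X $ Inl v $ Inl v' = 0"
      using bounds by (subst (asm) sum_nonneg_eq_0_iff) auto
    then show ?thesis by simp
  qed
  show ?thesis
    using HH GH GG sym by (simp add: vec_sum_eq_iff outer_def)
qed

section \<open>The optimal pair and the failure of strict complementarity\<close>

lemma matrix_mult_column: "(A ** B) $ i $ j = (A *v column j B) $ i"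
  by (simp add: matrix_matrix_mult_def matrix_vector_mult_def column_def)

lemma cosum_weight_pos:
  assumes "simple_graph EG" and "simple_graph EH"
    and "\<forall>e\<in>EG. 0 < wG e" and "\<forall>e\<in>EH. 0 < wH e" and "0 < \<alpha>"
    and "e \<in> cosum EG EH"
  shows "0 < cosum_weight wG wH \<alpha> e"
proof -
  have "e \<noteq> {}" if "e \<in> EG" for e using assms(1) that by (auto elim: simple_graph_edgeE)
  moreover have "e \<noteq> {}" if "e \<in> EH" for e using assms(2) that by (auto elim: simple_graph_edgeE)
  ultimately show ?thesis
    using assms(3-6) by (auto simp: cosum_def cosum_weight_Inl cosum_weight_Inr cosum_weight_cross)
qed

theorem theorem7:
  fixes EG :: "'g::finite set set" and EH :: "'h::finite set set"
    and wG :: "'g set \<Rightarrow> real" and wH :: "'h set \<Rightarrow> real"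
    and nG nH \<mu>G \<mu>H \<alpha> :: real
    and LG :: "real^'g^'g" and LH :: "real^'h^'h"
    and wbar :: "('g + 'h) set \<Rightarrow> real"
    and C Xs Ss :: "real^('g + 'h)^('g + 'h)" and ys :: "real^('g + 'h)"
  assumes "simple_graph EG" and "simple_graph EH"
    and "\<forall>e\<in>EG. wG e > 0" and "\<forall>e\<in>EH. wH e > 0"
    and "nG = real CARD('g)" and "nH = real CARD('h)"
    and "LG = laplacian EG wG" and "LH = laplacian EH wH"
    and "\<mu>G = lambda_max LG" and "\<mu>H = lambda_max LH"
    and "nG * \<mu>G > nH * \<mu>H"
    and "connected_graph EH"
    and "\<alpha> = \<mu>G / nH"
    and "wbar = cosum_weight wG wH \<alpha>"
    and "C = laplacian (cosum EG EH) wbar"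
    and "Xs = outer (- 1 \<oplus>\<^sub>v 1) (- 1 \<oplus>\<^sub>v 1)"
    and "ys = (2 * \<alpha>) *\<^sub>R (nH *\<^sub>R 1 \<oplus>\<^sub>v nG *\<^sub>R 1)"
    and "Ss = block_matrix
                (\<mu>G *\<^sub>R mat 1 - LG)      (\<alpha> *\<^sub>R outer 1 1)
                (\<alpha> *\<^sub>R outer 1 1)         ((\<alpha> * nG) *\<^sub>R mat 1 - LH)"
  shows "(\<forall>e\<in>cosum EG EH. wbar e > 0)
    \<and> {(X, y, S). primal_optimal C X \<and> dual_optimal C y S} = {(Xs, ys, Ss)}
    \<and> (\<forall>h. eigenvector LG h \<mu>G \<longrightarrow> (Xs + Ss) *v (h \<oplus>\<^sub>v 0) = 0)
    \<and> \<not> (\<exists>X y S. primal_optimal C X \<and> dual_optimal C y S \<and> strictly_complementary C X y S)"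


proof -
  note G = assms(1) and H = assms(2)
  let ?s = "- 1 \<oplus>\<^sub>v 1 :: real^('g + 'h)"
  have n: "0 < nG" "0 < nH" by (simp_all add: assms(5,6))
  have LG: "transpose LG = LG" "LG *v 1 = 0" and LH: "transpose LH = LH" "LH *v 1 = 0"
    using G H by (simp_all add: assms(7,8) transpose_laplacian laplacian_mult_one)
  \<comment> \<open>The vector \<open>1\<close> is an eigenvector of \<open>LH\<close> for 0. The
    strict inequality then makes \<open>\<mu>G\<close>, and so \<alpha>, positive.\<close>
  have "0 \<le> \<mu>H"
    unfolding assms(10)
    by (rule lambda_max_ge[OF LH(1), of 1]) (simp add: eigenvector_def LH(2) one_vec_neq_zero)
  then have "0 < nG * \<mu>G"
    using assms(11) n by (meson mult_nonneg_nonneg less_imp_le order_le_less_trans)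
  then have \<mu>: "0 < \<mu>G" using n by (simp add: zero_less_mult_iff)
  have \<mu>\<alpha>: "\<mu>G = \<alpha> * nH" and \<alpha>: "0 < \<alpha>" using n \<mu> by (simp_all add: assms(13))
  have less: "lambda_max LH < \<alpha> * nG"
    using assms(11) n by (simp add: assms(13) field_simps flip: assms(10))
  note S = dual_matrix_psd_kernel[OF LG LH \<mu>\<alpha>[unfolded assms(6)] assms(9) \<mu>
      less[unfolded assms(5)], folded assms(5), folded assms(18)]
  have Xs: "primal_feasible Xs"
    unfolding assms(16) primal_feasible_def
    by (intro conjI psd_outer) (simp add: diag_def vec_sum_eq_iff outer_def)
  \<comment> \<open>On \<open>'g\<close>, the entries of \<open>ys\<close> are
    \<open>2 * \<mu>G\<close> and the block of \<open>C\<close> is \<open>LG\<close> plus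
    \<open>\<mu>G\<close> times the identity. The block on \<open>'h\<close> is analogous with
    \<open>\<alpha> * nG\<close>.\<close>
  have "Ss = Diag ys - C"
    unfolding assms(14,15,17,18) laplacian_cosum[OF G H]
    by (simp add: vec_sum_eq_iff Diag_def mat_def assms(5,6) \<mu>\<alpha> outer_def vec_eq_iff
        flip: assms(7,8))
  then have ySs: "dual_feasible C ys Ss" using S(1) by (simp add: dual_feasible_def)
  \<comment> \<open>The components are \<open>- \<mu>G + \<alpha> * nH\<close> on \<open>'g\<close>
    and \<open>- \<alpha> * nG + \<alpha> * nG\<close> on \<open>'h\<close>.\<close>
  have Ss_s: "Ss *v ?s = 0"
    using LG(2) LH(2)
    by (simp add: assms(18) block_matrix_mult_dsum matrix_vector_mult_diff_rdistrib
        scaleR_matrix_vector_assoc[symmetric] outer_mult_vector inner_one_one vec.neg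
        \<mu>\<alpha> assms(5,6) vec_sum_eq_iff)
  then have SX: "Ss ** Xs = 0"
    by (simp add: assms(16) matrix_mult_outer) (simp add: outer_def vec_eq_iff)
  have primal: "primal_optimal C X \<longleftrightarrow> X = Xs" for X
    unfolding primal_optimal_iff[OF Xs ySs SX]
  proof
    assume X: "primal_feasible X \<and> Ss ** X = 0"
    have "Ss *v column k X = 0" for k
      using X matrix_mult_column[of Ss X _ k] by (simp add: vec_eq_iff)
    from S(2)[OF this] show "X = Xs"
      unfolding assms(16) using X assms(5)
      by (intro primal_feasible_eq_outer) (simp_all add: column_def)
  qed (use Xs SX in simp)
  have dual: "dual_optimal C y S \<longleftrightarrow> y = ys \<and> S = Ss" for y S
    unfolding dual_optimal_iff[OF Xs ySs SX]
  proof
    assume yS: "dual_feasible C y S \<and> S ** Xs = 0"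
    have Diag_mult: "(Diag z *v x) $ k = z $ k * x $ k" for z x :: "real^('g + 'h)" and k
      by (simp add: Diag_def matrix_vector_mult_def if_distrib[where f = "\<lambda>x. x * _"] cong: if_cong)
    have "outer (S *v ?s) ?s = 0"
      using yS by (simp add: assms(16) matrix_mult_outer)
    then have "(S *v ?s) $ k * ?s $ k = 0" for k
      by (auto simp: outer_def vec_eq_iff)
    moreover have s: "?s $ k \<noteq> 0" for k by (cases k) simp_all
    ultimately have "S *v ?s = 0" by (simp add: vec_eq_iff)
    \<comment> \<open>Both slack matrices annihilate \<open>?s\<close>, and their common term
      \<open>C\<close> cancels.\<close>
    then have "Diag y *v ?s = Diag ys *v ?s"
      using Ss_s yS ySs by (simp add: dual_feasible_def matrix_vector_mult_diff_rdistrib)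
    then have "y $ k * ?s $ k = ys $ k * ?s $ k" for k
      by (metis Diag_mult)
    then have "y = ys" using s by (simp add: vec_eq_iff)
    then show "y = ys \<and> S = Ss" using yS ySs by (simp add: dual_feasible_def)
  qed (use ySs SX in simp)
  have top: "(Xs + Ss) *v (h \<oplus>\<^sub>v 0) = 0" if h: "eigenvector LG h \<mu>G" for h
  proof -
    \<comment> \<open>Since \<open>LG\<close> annihilates \<open>1\<close>, a top eigenvector is
      orthogonal to \<open>1\<close>, which kills \<open>Xs\<close> and the off-diagonal
      block.\<close>
    have "\<mu>G * (1 \<bullet> h) = 0"
      using symmetric_inner_matrix[OF LG(1), of 1 h] h LG(2) by (simp add: eigenvector_def)
    then have "1 \<bullet> h = 0" using \<mu> by simp
    then show ?thesis
      using h by (simp add: assms(16,18) eigenvector_def matrix_vector_mult_add_rdistrib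
          outer_mult_vector inner_dsum block_matrix_mult_dsum matrix_vector_mult_diff_rdistrib
          scaleR_matrix_vector_assoc[symmetric] vec_sum_eq_iff)
  qed
  obtain h where h: "eigenvector LG h \<mu>G"
    using lambda_max_Rayleigh[OF LG(1)] assms(9) by blast
  \<comment> \<open>A nonzero kernel vector excludes positive definiteness for the only optimal
    pair.\<close>
  have "h \<oplus>\<^sub>v (0 :: real^'h) \<noteq> 0"
    using h by (simp add: eigenvector_def vec_sum_eq_iff) (simp add: vec_eq_iff)
  then have "\<not> pos_def (Xs + Ss)"
    using top[OF h] by (metis inner_zero_right less_irrefl pos_def_def)
  moreover have "\<forall>e\<in>cosum EG EH. wbar e > 0"
    using cosum_weight_pos[OF assms(1-4) \<alpha>] by (simp add: assms(14))
  ultimately show ?thesis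
    using primal dual top by (auto simp: strictly_complementary_def)
qed

end
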